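(* There is no formula $\varphi\in\mathcal L_{\mathcal U}$ such that $\Box p\leftrightarrow\varphi$ is valid over the class of finite temporal here-and-there models (where $p$ is a propositional variable). That is, the connective $\Box$ is not $\mathcal L_{\mathcal U}$-definable, even over the class of finite here-and-there models.
   Context: Formulas of $\mathcal L$ are generated by $\varphi::=p\mid\bot\mid\varphi\wedge\varphi\mid\varphi\vee\varphi\mid\varphi\to\varphi\mid\bigcirc\varphi\mid\Diamond\varphi\mid\Box\varphi\mid\varphi\,\mathcal U\,\varphi\mid\varphi\,\mathcal R\,\varphi$, with $p$ ranging over a countable set of propositional variables; $\neg\varphi:=\varphi\to\bot$, $\top:=\neg\bot$, $\varphi\leftrightarrow\psi:=(\varphi\to\psi)\wedge(\psi\to\varphi)$. $\mathcal L_{\mathcal U}$ is the fragment built from variables, $\bot,\wedge,\vee,\to,\bigcirc$ and $\mathcal U$ only. A dynamic poset is $(W,\preccurlyeq,S)$ with $W\ne\emptyset$, $\preccurlyeq$ a partial order and $S:W\to W$ such that $w\preccurlyeq v$ implies $S(w)\preccurlyeq S(v)$. A model is $(W,\preccurlyeq,S,V)$ with $(W,\preccurlyeq,S)$ a dynamic poset and $V$ assigning to each world a set of variables with $w\preccurlyeq v\Rightarrow V(w)\subseteq V(v)$. Satisfaction: $w\models p$ iff $p\in V(w)$; $w\not\models\bot$; $\wedge,\vee$ classical; $w\models\varphi\to\psi$ iff for all $v\succcurlyeq w$, $v\models\varphi$ implies $v\models\psi$; $w\models\bigcirc\varphi$ iff $S(w)\models\varphi$; $w\models\Diamond\varphi$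 iff $S^k(w)\models\varphi$ for some $k\ge0$; $w\models\Box\varphi$ iff $S^k(w)\models\varphi$ for all $k\ge0$; $w\models\varphi\,\mathcal U\,\psi$ iff there is $k\ge0$ with $S^k(w)\models\psi$ and $S^i(w)\models\varphi$ for all $i\in[0,k)$; $w\models\varphi\,\mathcal R\,\psi$ iff for all $k\ge0$, either $S^k(w)\models\psi$ or $S^i(w)\models\varphi$ for some $i\in[0,k)$. A formula is valid over a class of models if it holds at every world of every model in the class. A temporal here-and-there frame is a dynamic poset $(W,\preccurlyeq,S)$ with $W=T\times\{0,1\}$ for some set $T$ and a function $f:T\to T$ such that $(t,i)\preccurlyeq(s,j)$ iff $t=s$ and $i\le j$, and $S(t,i)=(f(t),i)$; a here-and-there model is a model on such a frame; it is finite if $W$ is finite. *)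

theory Defs
  imports Main "HOL-Library.Countable" "HOL-Library.FuncSet"
begin

datatype 'v fm =
    Var 'v
  | Bot
  | And "'v fm" "'v fm"
  | Or "'v fm" "'v fm"
  | Imp "'v fm" "'v fm"
  | Next "'v fm"
  | Dia "'v fm"
  | Box "'v fm"
  | Until "'v fm" "'v fm"
  | Release "'v fm" "'v fm"

definition Iff :: "'v fm \<Rightarrow> 'v fm \<Rightarrow> 'v fm" where
  "Iff \<phi> \<psi> = And (Imp \<phi> \<psi>) (Imp \<psi> \<phi>)"

inductive_set L_U :: "'v fm set" where
  "Var p \<in> L_U"
| "Bot \<in> L_U"
| "\<phi> \<in> L_U \<Longrightarrow> \<psi> \<in> L_U \<Longrightarrow> And \<phi> \<psi> \<in> L_U"
| "\<phi> \<in> L_U \<Longrightarrow> \<psi> \<in> L_U \<Longrightarrow> Or \<phi> \<psi> \<in> L_U"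
| "\<phi> \<in> L_U \<Longrightarrow> \<psi> \<in> L_U \<Longrightarrow> Imp \<phi> \<psi> \<in> L_U"
| "\<phi> \<in> L_U \<Longrightarrow> Next \<phi> \<in> L_U"
| "\<phi> \<in> L_U \<Longrightarrow> \<psi> \<in> L_U \<Longrightarrow> Until \<phi> \<psi> \<in> L_U"

record 'w frame =
  worlds :: "'w set"
  ord :: "('w \<times> 'w) set"
  step :: "'w \<Rightarrow> 'w"

record ('w, 'v) model = "'w frame" +
  val :: "'w \<Rightarrow> 'v set"

definition dynamic_poset :: "('w, 'x) frame_scheme \<Rightarrow> bool" where
  "dynamic_poset F \<longleftrightarrow>
     worlds F \<noteq> {} \<and>
     partial_order_on (worlds F) (ord F) \<and>
     step F \<in> worlds F \<rightarrow> worlds F \<and>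
     (\<forall>w\<in>worlds F. \<forall>v\<in>worlds F. (w, v) \<in> ord F \<longrightarrow> (step F w, step F v) \<in> ord F)"

definition is_model :: "('w, 'v) model \<Rightarrow> bool" where
  "is_model M \<longleftrightarrow>
     dynamic_poset M \<and>
     (\<forall>w\<in>worlds M. \<forall>v\<in>worlds M. (w, v) \<in> ord M \<longrightarrow> val M w \<subseteq> val M v)"

primrec sat :: "('w, 'v) model \<Rightarrow> 'w \<Rightarrow> 'v fm \<Rightarrow> bool" where
  "sat M w (Var p) \<longleftrightarrow> p \<in> val M w"
| "sat M w Bot \<longleftrightarrow> False"
| "sat M w (And \<phi> \<psi>) \<longleftrightarrow> sat M w \<phi> \<and> sat M w \<psi>"
| "sat M w (Or \<phi> \<psi>) \<longleftrightarrow> sat M w \<phi> \<or> sat M w \<psi>"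
| "sat M w (Imp \<phi> \<psi>) \<longleftrightarrow>
     (\<forall>v\<in>worlds M. (w, v) \<in> ord M \<longrightarrow> sat M v \<phi> \<longrightarrow> sat M v \<psi>)"
| "sat M w (Next \<phi>) \<longleftrightarrow> sat M (step M w) \<phi>"
| "sat M w (Dia \<phi>) \<longleftrightarrow> (\<exists>k. sat M ((step M ^^ k) w) \<phi>)"
| "sat M w (Box \<phi>) \<longleftrightarrow> (\<forall>k. sat M ((step M ^^ k) w) \<phi>)"
| "sat M w (Until \<phi> \<psi>) \<longleftrightarrow>
     (\<exists>k. sat M ((step M ^^ k) w) \<psi> \<and> (\<forall>i<k. sat M ((step M ^^ i) w) \<phi>))"
| "sat M w (Release \<phi> \<psi>) \<longleftrightarrow>
     (\<forall>k. sat M ((step M ^^ k) w) \<psi> \<or> (\<exists>i<k. sat M ((step M ^^ i) w) \<phi>))"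

definition valid_over :: "('w, 'v) model set \<Rightarrow> 'v fm \<Rightarrow> bool" where
  "valid_over C \<phi> \<longleftrightarrow> (\<forall>M\<in>C. \<forall>w\<in>worlds M. sat M w \<phi>)"

definition ht_frame :: "('t \<times> nat, 'x) frame_scheme \<Rightarrow> bool" where
  "ht_frame F \<longleftrightarrow>
     dynamic_poset F \<and>
     (\<exists>T f. worlds F = T \<times> {0, 1} \<and> f \<in> T \<rightarrow> T \<and>
        (\<forall>t\<in>T. \<forall>s\<in>T. \<forall>i\<in>{0, 1}. \<forall>j\<in>{0, 1}.
           ((t, i), (s, j)) \<in> ord F \<longleftrightarrow> t = s \<and> i \<le> j) \<and>
        (\<forall>t\<in>T. \<forall>i\<in>{0, 1}. step F (t, i) = (f t, i)))"

definition finite_ht_models :: "('t \<times> nat, 'v) model set" where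
  "finite_ht_models = {M. is_model M \<and> ht_frame M \<and> finite (worlds M)}"

text \<open>
  HOL cannot quantify over the types of time points inside a formula. Every finite here-and-there
  model is isomorphic to one whose time points are natural numbers, so validity over all finite
  here-and-there models amounts to validity over the class below.
\<close>

abbreviation finite_ht_models_nat :: "(nat \<times> nat, 'v) model set" where
  "finite_ht_models_nat \<equiv> finite_ht_models"

end

(* In a here-and-there model whose upper level makes every variable true everywhere, all formulas are
   constant along the upper level. Let the lower level run 0, 1, ..., N with a loop at N, and let the
   variables fail only at the lower point N. A formula of L_U that holds on the upper level then holds
   at every lower point far enough from N: only Next moves towards N, whereas an Until formula
   that holds above is already witnessed at k = 0. Hence a formula equivalent to Box p would hold at
   the lower point 0, although p fails at the lower point N. *)
theory Submission
  imports Defs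
begin

text \<open>The bounds \<open>t \<le> N\<close> and \<open>j \<le> 1\<close> keep the order inside
  the set of worlds, and \<open>min\<close> turns \<open>N\<close> into a fixed point. All variables
  share one valuation, so the model is the same for every choice of \<open>p\<close>.\<close>

definition defect_model :: "nat \<Rightarrow> (nat \<times> nat, 'v) model" where
  "defect_model N =
     \<lparr>worlds = {..N} \<times> {0, 1},
      ord = {((t, i), (s, j)). t = s \<and> t \<le> N \<and> i \<le> j \<and> j \<le> 1},
      step = (\<lambda>(t, i). (min (Suc t) N, i)),
      val = (\<lambda>(t, i). if i = 1 \<or> t < N then UNIV else {})\<rparr>"

lemma worlds_defect_model [simp]: "worlds (defect_model N) = {..N} \<times> {0, 1}"
  and ord_defect_model [simp]:
    "((t, i), (s, j)) \<in> ord (defect_model N) \<longleftrightarrow> t = s \<and> t \<le> N \<and> i \<le> j \<and> j \<le> 1"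
  and step_defect_model [simp]: "step (defect_model N) (t, i) = (min (Suc t) N, i)"
  and val_defect_model [simp]:
    "val (defect_model N) (t, i) = (if i = 1 \<or> t < N then UNIV else {})"
  by (simp_all add: defect_model_def)

lemma steps_defect_model [simp]:
  "t \<le> N \<Longrightarrow> (step (defect_model N) ^^ k) (t, i) = (min (t + k) N, i)"
  by (induction k) auto

lemma dynamic_poset_defect_model: "dynamic_poset (defect_model N)"
  unfolding dynamic_poset_def partial_order_on_def preorder_on_def
proof (intro conjI)
  show "refl_on (worlds (defect_model N)) (ord (defect_model N))"
    by (auto simp: refl_on_def)
  show "trans (ord (defect_model N))"
    by (auto simp: trans_def)
  show "antisym (ord (defect_model N))"
    by (auto simp: antisym_def)
qed (auto simp: defect_model_def)

lemma defect_model_in_finite_ht_models: "defect_model N \<in> finite_ht_models"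
proof -
  have "is_model (defect_model N)"
    using dynamic_poset_defect_model by (auto simp: is_model_def)
  moreover have "ht_frame (defect_model N)"
    unfolding ht_frame_def
    by (intro conjI dynamic_poset_defect_model exI[of _ "{..N}"] exI[of _ "\<lambda>t. min (Suc t) N"]) auto
  ultimately show ?thesis
    by (simp add: finite_ht_models_def)
qed

text \<open>Upper points are maximal, so implication is classical there.\<close>

lemma sat_Imp_upper:
  assumes "t \<le> N"
  shows "sat (defect_model N) (t, 1) (Imp \<phi> \<psi>) \<longleftrightarrow>
    (sat (defect_model N) (t, 1) \<phi> \<longrightarrow> sat (defect_model N) (t, 1) \<psi>)"
  using assms by auto

text \<open>The only points above \<open>(t, 0)\<close> are itself and
  \<open>(t, 1)\<close>.\<close>

lemma sat_Imp_lower: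
  assumes "t \<le> N"
  shows "sat (defect_model N) (t, 0) (Imp \<phi> \<psi>) \<longleftrightarrow>
    (sat (defect_model N) (t, 0) \<phi> \<longrightarrow> sat (defect_model N) (t, 0) \<psi>) \<and>
    sat (defect_model N) (t, 1) (Imp \<phi> \<psi>)"
  using assms by auto

lemma sat_upper_constant:
  "\<phi> \<in> L_U \<Longrightarrow> t \<le> N \<Longrightarrow> sat (defect_model N) (t, 1) \<phi> \<longleftrightarrow> sat (defect_model N) (0, 1) \<phi>"
proof (induction arbitrary: t rule: L_U.induct)
  case (5 \<phi> \<psi>)
  show ?case
    using "5.IH"[OF "5.prems"] sat_Imp_upper[OF "5.prems", of \<phi> \<psi>]
      sat_Imp_upper[of 0 N \<phi> \<psi>] by blast
next
  case (6 \<phi>)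
  show ?case
    \<comment> \<open>These are the successors of \<open>t\<close> and of 0; \<open>min 1 N\<close>
      covers the case \<open>N = 0\<close>.\<close>
    using "6.IH"[of "min (Suc t) N"] "6.IH"[of "min 1 N"] by simp
next
  case (7 \<phi> \<psi>)
  \<comment> \<open>By constancy of \<psi>, any witness on the upper level can be moved to
    \<open>k = 0\<close>, where the condition on \<phi> is vacuous.\<close>
  have "sat (defect_model N) (s, 1) (Until \<phi> \<psi>) \<longleftrightarrow> sat (defect_model N) (0, 1) \<psi>"
    if s: "s \<le> N" for s
  proof
    assume "sat (defect_model N) (s, 1) (Until \<phi> \<psi>)"
    then obtain k where "sat (defect_model N) (min (s + k) N, 1) \<psi>"
      using s by auto
    then show "sat (defect_model N) (0, 1) \<psi>"
      using "7.IH"(2)[of "min (s + k) N"] by simp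
  next
    assume "sat (defect_model N) (0, 1) \<psi>"
    then have "sat (defect_model N) (s, 1) \<psi>"
      using "7.IH"(2)[OF s] by simp
    then show "sat (defect_model N) (s, 1) (Until \<phi> \<psi>)"
      unfolding sat.simps by (intro exI[of _ 0]) simp
  qed
  from this[OF "7.prems"] this[of 0] show ?case
    by simp
next
  case (3 \<phi> \<psi>)
  show ?case
    using "3.IH"[OF "3.prems"] by simp
next
  case (4 \<phi> \<psi>)
  show ?case
    using "4.IH"[OF "4.prems"] by simp
qed auto

text \<open>Persistence along the order: the step acts alike on both levels, so a witness for
  \<open>Until\<close> below also serves above.\<close>

lemma sat_lower_imp_upper:
  "\<phi> \<in> L_U \<Longrightarrow> t \<le> N \<Longrightarrow> sat (defect_model N) (t, 0) \<phi> \<Longrightarrow> sat (defect_model N) (t, 1) \<phi>"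
proof (induction arbitrary: t rule: L_U.induct)
  case (7 \<phi> \<psi>)
  then show ?case
    unfolding sat.simps by (metis min.cobounded2 steps_defect_model)
qed auto

text \<open>The margin \<open>d\<close> depends on the formula alone, so that \<open>N\<close> can
  be chosen after it. The inequality is strict because variables already fail at the lower point
  \<open>N\<close>.\<close>

lemma sat_lower_iff_upper:
  "\<phi> \<in> L_U \<Longrightarrow> \<exists>d. \<forall>N t. t + d < N \<longrightarrow>
     (sat (defect_model N) (t, 0) \<phi> \<longleftrightarrow> sat (defect_model N) (0, 1) \<phi>)"
proof (induction rule: L_U.induct)
  case (1 p)
  show ?case
    by (rule exI[of _ 0]) simp
next
  case 2
  show ?case
    by simp
next
  case (3 \<phi> \<psi>)
  then obtain d e where
    "\<forall>N t. t + d < N \<longrightarrow> sat (defect_model N) (t, 0) \<phi> = sat (defect_model N) (0, 1) \<phi>"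
    "\<forall>N t. t + e < N \<longrightarrow> sat (defect_model N) (t, 0) \<psi> = sat (defect_model N) (0, 1) \<psi>"
    by blast
  then show ?case
    \<comment> \<open>The sum is a convenient common upper bound of the two margins.\<close>
    by (intro exI[of _ "d + e"]) simp
next
  case (4 \<phi> \<psi>)
  then obtain d e where
    "\<forall>N t. t + d < N \<longrightarrow> sat (defect_model N) (t, 0) \<phi> = sat (defect_model N) (0, 1) \<phi>"
    "\<forall>N t. t + e < N \<longrightarrow> sat (defect_model N) (t, 0) \<psi> = sat (defect_model N) (0, 1) \<psi>"
    by blast
  then show ?case
    by (intro exI[of _ "d + e"]) simp
next
  case (5 \<phi> \<psi>)
  then obtain d e where
    d: "\<forall>N t. t + d < N \<longrightarrow> sat (defect_model N) (t, 0) \<phi> = sat (defect_model N) (0, 1) \<phi>" and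
    e: "\<forall>N t. t + e < N \<longrightarrow> sat (defect_model N) (t, 0) \<psi> = sat (defect_model N) (0, 1) \<psi>"
    by blast
  have "sat (defect_model N) (t, 0) (Imp \<phi> \<psi>) \<longleftrightarrow> sat (defect_model N) (0, 1) (Imp \<phi> \<psi>)"
    if less: "t + (d + e) < N" for N t
  proof -
    have "t \<le> N" "t + d < N" "t + e < N"
      using less by auto
    then show ?thesis
      using d e sat_upper_constant[OF 5(1) \<open>t \<le> N\<close>] sat_upper_constant[OF 5(2) \<open>t \<le> N\<close>]
        sat_Imp_lower[OF \<open>t \<le> N\<close>, of \<phi> \<psi>] sat_Imp_upper[OF \<open>t \<le> N\<close>, of \<phi> \<psi>]
        sat_Imp_upper[of 0 N \<phi> \<psi>]
      by blast
  qed
  then show ?case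
    by blast
next
  case (6 \<phi>)
  then obtain d where
    d: "\<forall>N t. t + d < N \<longrightarrow> sat (defect_model N) (t, 0) \<phi> = sat (defect_model N) (0, 1) \<phi>"
    by blast
  show ?case
  proof (intro exI allI impI)
    fix N t
    \<comment> \<open>\<open>Next\<close> costs one unit of margin, since \<phi> is evaluated at
      \<open>Suc t\<close>.\<close>
    assume "t + Suc d < N"
    then show "sat (defect_model N) (t, 0) (Next \<phi>) \<longleftrightarrow> sat (defect_model N) (0, 1) (Next \<phi>)"
      using d sat_upper_constant[OF 6(1), of 1 N] by simp
  qed
next
  case (7 \<phi> \<psi>)
  then obtain d where
    d: "\<forall>N t. t + d < N \<longrightarrow> sat (defect_model N) (t, 0) \<psi> = sat (defect_model N) (0, 1) \<psi>"
    by blast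
  have "sat (defect_model N) (t, 0) (Until \<phi> \<psi>) \<longleftrightarrow> sat (defect_model N) (0, 1) (Until \<phi> \<psi>)"
    if "t + d < N" for N t
  proof
    assume "sat (defect_model N) (t, 0) (Until \<phi> \<psi>)"
    \<comment> \<open>The witness below may lie beyond the margin, where the induction hypothesis is
      silent; persistence avoids this by moving up at \<open>t\<close> itself.\<close>
    then have "sat (defect_model N) (t, 1) (Until \<phi> \<psi>)"
      using 7(1,2) that by (intro sat_lower_imp_upper L_U.intros) auto
    then show "sat (defect_model N) (0, 1) (Until \<phi> \<psi>)"
      using 7(1,2) that sat_upper_constant[of "Until \<phi> \<psi>" t N] by (simp add: L_U.intros)
  next
    assume "sat (defect_model N) (0, 1) (Until \<phi> \<psi>)"
    then obtain k where "sat (defect_model N) (min k N, 1) \<psi>"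
      by auto
    then have "sat (defect_model N) (0, 1) \<psi>"
      using sat_upper_constant[OF 7(2), of "min k N" N] by simp
    then have "sat (defect_model N) (t, 0) \<psi>"
      using d that by blast
    then show "sat (defect_model N) (t, 0) (Until \<phi> \<psi>)"
      unfolding sat.simps by (intro exI[of _ 0]) simp
  qed
  then show ?case
    by blast
qed

theorem mainTheorem1:
  fixes p :: "'v :: countable"
  shows "\<not> (\<exists>\<phi> \<in> L_U. valid_over finite_ht_models_nat (Iff (Box (Var p)) \<phi>))"
proof
  assume "\<exists>\<phi> \<in> L_U. valid_over finite_ht_models_nat (Iff (Box (Var p)) \<phi>)"
  then obtain \<phi> where \<phi>: "\<phi> \<in> L_U"
    and valid: "valid_over finite_ht_models_nat (Iff (Box (Var p)) \<phi>)"
    by blast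
  obtain d where d: "\<forall>N t. t + d < N \<longrightarrow>
      (sat (defect_model N) (t, 0) \<phi> \<longleftrightarrow> sat (defect_model N) (0, 1) \<phi>)"
    using sat_lower_iff_upper[OF \<phi>] by blast
  \<comment> \<open>\<open>Suc d\<close> is the least \<open>N\<close> for which the margin covers
    \<open>t = 0\<close>.\<close>
  let ?M = "defect_model (Suc d) :: (nat \<times> nat, 'v) model"
  have iff: "sat ?M (0, i) (Box (Var p)) \<longleftrightarrow> sat ?M (0, i) \<phi>" if "i \<in> {0, 1}" for i
  proof -
    have "sat ?M (0, i) (Iff (Box (Var p)) \<phi>)"
      using valid defect_model_in_finite_ht_models that unfolding valid_over_def by fastforce
    moreover have "(0, i) \<in> worlds ?M" "((0, i), (0, i)) \<in> ord ?M"
      using that by auto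
    ultimately show ?thesis
      unfolding Iff_def sat.simps(3,5) by blast
  qed
  have "sat ?M (0, 1) (Box (Var p))"
    by simp
  then have "sat ?M (0, 0) \<phi>"
    using iff[of 1] d by simp
  then have "sat ?M (0, 0) (Box (Var p))"
    using iff[of 0] by simp
  then show False
    \<comment> \<open>After \<open>Suc d\<close> steps the lower path from 0 reaches the defect,
      where \<open>p\<close> fails.\<close>
    by (auto dest: spec[of _ "Suc d"])
qed

end
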